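(* Let $\mathcal{H},\mathcal{K}$ be real or complex Hilbert spaces, let $S$ be a linear operator from $\mathcal{H}$ to $\mathcal{K}$ and $T$ a linear operator from $\mathcal{K}$ to $\mathcal{H}$ (neither assumed densely defined, closed or bounded) which are adjoint to each other, and assume that $\overline{\operatorname{ran}S}\cap pr_{\mathcal{K}}\langle W\langle G(S)^{\perp}\rangle\rangle\subseteq\operatorname{dom}T$. For a given $z\in\mathcal{H}$ the following assertions are equivalent: (i) $z\in\operatorname{ran}T+(\operatorname{dom}S)^{\perp}$; (ii) there is $M_z\geq 0$ such that $|(x\mid z)|\leq M_z\|Sx\|$ for all $x\in\operatorname{dom}S$.
   Context: A linear operator from $\mathcal{H}$ to $\mathcal{K}$ is a linear map defined on a linear subspace $\operatorname{dom} S\subseteq\mathcal{H}$ with values in $\mathcal{K}$. $S$ and $T$ are adjoint to each other ($S\wedge T$) if $(Sh\mid k)=(h\mid Tk)$ for all $h\in\operatorname{dom}S$, $k\in\operatorname{dom}T$. $G(S)=\{(h,Sh): h\in\operatorname{dom}S\}\subseteq\mathcal{H}\times\mathcal{K}$ is the graph, $\perp$ of the graph is taken in the product Hilbert space. Here $W:\mathcal{H}\times\mathcal{K}\to\mathcal{K}\times\mathcal{H}$ is the flip $W(h,k)=(-k,h)$, $pr_{\mathcal{K}}$ is the canonical projection of the product space onto $\mathcal{K}$, and $\langle\cdot\rangle$ denotes image of a set; thus $pr_{\mathcal{K}}\langle W\langle G(S)^{\perp}\rangle\rangle=\{k\in\mathcal{K}:\exists h\in\mathcal{H},\ (h,k)\in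 G(S)^{\perp}\}$. *)

theory Defs
  imports "HOL-Analysis.Analysis"
begin

section \<open>Scalars: the real or the complex numbers\<close>

text \<open>
  One class covers both scalar fields, so that "real or complex Hilbert space" can be
  stated once. Besides the two instances below there is nothing else in this class, up
  to isomorphism: see \<open>scalar_conj_cases\<close>.
\<close>

class real_or_complex = real_normed_field +
  fixes scalar_conj :: "'a \<Rightarrow> 'a"
  assumes scalar_conj_add: "scalar_conj (x + y) = scalar_conj x + scalar_conj y"
    and scalar_conj_mult: "scalar_conj (x * y) = scalar_conj x * scalar_conj y"
    and scalar_conj_conj: "scalar_conj (scalar_conj x) = x"
    and add_scalar_conj_real: "\<exists>r. x + scalar_conj x = r *\<^sub>R 1"
    and mult_scalar_conj: "x * scalar_conj x = (norm x)\<^sup>2 *\<^sub>R 1"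

instantiation real :: real_or_complex
begin

definition scalar_conj_real_def: "scalar_conj x = (x :: real)"

instance
  by standard (auto simp: scalar_conj_real_def power2_eq_square)

end

instantiation complex :: real_or_complex
begin

definition scalar_conj_complex_def: "scalar_conj x = cnj x"

instance
proof
  fix x y :: complex
  show "scalar_conj (x + y) = scalar_conj x + scalar_conj y"
    "scalar_conj (x * y) = scalar_conj x * scalar_conj y"
    "scalar_conj (scalar_conj x) = x"
    by (simp_all add: scalar_conj_complex_def)
  show "\<exists>r. x + scalar_conj x = r *\<^sub>R 1"
    by (rule exI[of _ "2 * Re x"]) (simp add: scalar_conj_complex_def complex_eq_iff)
  show "x * scalar_conj x = (norm x)\<^sup>2 *\<^sub>R 1"
    by (simp add: scalar_conj_complex_def complex_eq_iff cmod_power2)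
      (simp add: power2_eq_square)
qed

end

lemma scalar_conj_real_iff:
  fixes x :: "'k :: real_or_complex"
  shows "scalar_conj x = x \<longleftrightarrow> x \<in> \<real>"
proof
  assume "scalar_conj x = x"
  moreover obtain r where "x + scalar_conj x = r *\<^sub>R 1"
    using add_scalar_conj_real by blast
  ultimately have "2 * x = of_real r"
    by (simp add: of_real_def)
  then have "x = of_real (r / 2)"
    by (simp add: nonzero_eq_divide_eq mult.commute)
  then show "x \<in> \<real>"
    by (metis Reals_of_real)
next
  assume "x \<in> \<real>"
  then obtain r where r: "x = of_real r"
    by (auto elim: Reals_cases)
  show "scalar_conj x = x"
  proof (cases "x = 0")
    case True
    have "norm (scalar_conj x) = 0"
      using scalar_conj_add[of 0 0] True by simp
    then show ?thesis
      using True by simp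
  next
    case False
    have "x * scalar_conj x = x * x"
      using mult_scalar_conj[of x] r by (simp add: of_real_def power2_eq_square)
    then show ?thesis
      using False by simp
  qed
qed

lemma scalar_conj_cases:
  fixes ty :: "'k :: real_or_complex itself"
  shows "(\<forall>x :: 'k. x \<in> \<real> \<and> scalar_conj x = x) \<or>
    (\<exists>i :: 'k. i * i = -1 \<and>
      (\<forall>x. \<exists>a b. x = of_real a + of_real b * i \<and> scalar_conj x = of_real a - of_real b * i))"
proof (cases "\<forall>x :: 'k. scalar_conj x = x")
  case True
  then show ?thesis
    using scalar_conj_real_iff by auto
next
  case False
  have zero: "scalar_conj (0 :: 'k) = 0"
    by (simp add: scalar_conj_real_iff)
  have neg: "scalar_conj (- x) = - scalar_conj x" for x :: 'k
    using scalar_conj_add[of x "- x"] zero by (simp add: eq_neg_iff_add_eq_0 add.commute)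
  obtain x :: 'k where x: "scalar_conj x \<noteq> x"
    using False by blast
  define d where "d = x - scalar_conj x"
  have d0: "d \<noteq> 0" and dc: "scalar_conj d = - d"
    using x scalar_conj_add[of x "- scalar_conj x"]
    by (simp_all add: d_def neg scalar_conj_conj)
  define i where "i = d / of_real (norm d)"
  have "d * d = - of_real ((norm d)\<^sup>2)"
    using mult_scalar_conj[of d] dc 
    by (metis minus_mult_right minus_minus of_real_def)
  then have ii: "i * i = -1"
    using d0 by (simp add: i_def power2_eq_square)
  have scale: "scalar_conj (of_real r * y) = of_real r * scalar_conj y" for r and y :: 'k
    using scalar_conj_mult[of "of_real r" y] by (simp add: scalar_conj_real_iff)
  have "i = of_real (1 / norm d) * d"
    by (simp add: i_def)
  then have ic: "scalar_conj i = - i"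
    using scale[of "1 / norm d" d] dc by simp
  have "\<exists>a b. y = of_real a + of_real b * i \<and> scalar_conj y = of_real a - of_real b * i"
    for y :: 'k
  proof -
    define e where "e = y - scalar_conj y"
    have "scalar_conj e = - e"
      using scalar_conj_add[of y "- scalar_conj y"] by (simp add: e_def neg scalar_conj_conj)
    then have "scalar_conj (e * i) = e * i"
      by (simp add: scalar_conj_mult ic)
    then have "e * i \<in> \<real>"
      by (simp add: scalar_conj_real_iff)
    then obtain b where b: "e * i = of_real b"
      by (auto elim: Reals_cases)
    have "e = - (e * i) * i"
      using ii by (simp add: mult.assoc)
    then have e: "e = of_real (- b) * i"
      using b by simp
    obtain a where a: "y + scalar_conj y = of_real a"
      using add_scalar_conj_real[of y] by (auto simp: of_real_def)
    have "y = (of_real a + e) / 2" "scalar_conj y = (of_real a - e) / 2"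
      using a by (simp_all add: e_def flip: a)
    then show ?thesis
      by (intro exI[of _ "a / 2"] exI[of _ "- b / 2"]) (simp add: e field_simps)
  qed
  then show ?thesis
    using ii by blast
qed


section \<open>Hilbert spaces\<close>

text \<open>
  The carrier is a Banach space, so that norm, closure and completeness are those of the
  library; the last axiom says that the norm is the one induced by the inner product,
  which is linear in its first argument.
\<close>

locale hilbert_space = vector_space scale
  for scale :: "'k :: real_or_complex \<Rightarrow> 'h :: banach \<Rightarrow> 'h" +
  fixes ip :: "'h \<Rightarrow> 'h \<Rightarrow> 'k"
  assumes scale_of_real: "scale (of_real r) x = r *\<^sub>R x"
    and ip_conj: "ip y x = scalar_conj (ip x y)"
    and ip_add_left: "ip (x + y) z = ip x z + ip y z"
    and ip_scale_left: "ip (scale c x) z = c * ip x z"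
    and ip_self: "ip x x = of_real ((norm x)\<^sup>2)"

lemma hilbert_space_real_inner:
  "hilbert_space (scaleR :: real \<Rightarrow> 'a \<Rightarrow> 'a :: {real_inner, banach}) inner"
  by unfold_locales
    (auto simp: scalar_conj_real_def inner_commute inner_add_left inner_add_right
      power2_norm_eq_inner scaleR_add_right scaleR_add_left)

lemma hilbert_space_complex:
  "hilbert_space ((*) :: complex \<Rightarrow> complex \<Rightarrow> complex) (\<lambda>x y. x * cnj y)"
  by unfold_locales
    (auto simp: scalar_conj_complex_def algebra_simps scaleR_conv_of_real
      complex_norm_square[symmetric] simp flip: of_real_power)

definition prod_scale ::
  "('k \<Rightarrow> 'h \<Rightarrow> 'h) \<Rightarrow> ('k \<Rightarrow> 'g \<Rightarrow> 'g) \<Rightarrow> 'k \<Rightarrow> 'h \<times> 'g \<Rightarrow> 'h \<times> 'g" where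
  "prod_scale sH sK c p = (sH c (fst p), sK c (snd p))"

definition prod_ip ::
  "('h \<Rightarrow> 'h \<Rightarrow> 'k :: plus) \<Rightarrow> ('g \<Rightarrow> 'g \<Rightarrow> 'k) \<Rightarrow> 'h \<times> 'g \<Rightarrow> 'h \<times> 'g \<Rightarrow> 'k" where
  "prod_ip ipH ipK p q = ipH (fst p) (fst q) + ipK (snd p) (snd q)"

lemma hilbert_space_prod:
  assumes "hilbert_space sH ipH" and "hilbert_space sK ipK"
  shows "hilbert_space (prod_scale sH sK) (prod_ip ipH ipK)"
proof -
  interpret H: hilbert_space sH ipH by fact
  interpret K: hilbert_space sK ipK by fact
  show ?thesis
    by unfold_locales
      (auto simp: prod_scale_def prod_ip_def H.scale_right_distrib K.scale_right_distrib
        H.scale_left_distrib K.scale_left_distrib H.scale_of_real K.scale_of_real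
        scalar_conj_add H.ip_conj[symmetric] K.ip_conj[symmetric] H.ip_add_left K.ip_add_left
        H.ip_scale_left K.ip_scale_left H.ip_self K.ip_self norm_prod_def distrib_left
        scaleR_prod_def)
qed

definition orth_compl :: "('h \<Rightarrow> 'h \<Rightarrow> 'k :: zero) \<Rightarrow> 'h set \<Rightarrow> 'h set" where
  "orth_compl ip A = {x. \<forall>y\<in>A. ip x y = 0}"


section \<open>Linear operators\<close>

text \<open>
  An operator is a partial function; its domain, range and graph are \<open>dom S\<close>, \<open>ran S\<close>
  and \<open>Map.graph S\<close>, and its value at \<open>h \<in> dom S\<close> is \<open>the (S h)\<close>.
\<close>

definition linear_operator ::
  "('k :: field \<Rightarrow> 'h :: ab_group_add \<Rightarrow> 'h) \<Rightarrow> ('k \<Rightarrow> 'g :: ab_group_add \<Rightarrow> 'g) \<Rightarrow>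
    ('h \<rightharpoonup> 'g) \<Rightarrow> bool" where
  "linear_operator sH sK S \<longleftrightarrow>
    module.subspace sH (dom S) \<and>
    (\<forall>x\<in>dom S. \<forall>y\<in>dom S. the (S (x + y)) = the (S x) + the (S y)) \<and>
    (\<forall>c. \<forall>x\<in>dom S. the (S (sH c x)) = sK c (the (S x)))"

definition adjoint_to_each_other ::
  "('h \<Rightarrow> 'h \<Rightarrow> 'k) \<Rightarrow> ('g \<Rightarrow> 'g \<Rightarrow> 'k) \<Rightarrow> ('h \<rightharpoonup> 'g) \<Rightarrow> ('g \<rightharpoonup> 'h) \<Rightarrow> bool" where
  "adjoint_to_each_other ipH ipK S T \<longleftrightarrow>
    (\<forall>h\<in>dom S. \<forall>k\<in>dom T. ipK (the (S h)) k = ipH h (the (T k)))"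

definition flip :: "'h \<times> 'g :: uminus \<Rightarrow> 'g \<times> 'h" where
  "flip p = (- snd p, fst p)"

end

theory Submission
  imports Defs
begin

text \<open>
  A bound \<open>\<bar>(x | z)\<bar> \<le> M * \<parallel>S x\<parallel>\<close> says exactly that \<open>S x \<mapsto> (x | z)\<close> is a well-defined bounded
  functional on \<open>ran S\<close>. The Riesz representation theorem yields \<open>k\<close> in the closure of \<open>ran S\<close> with
  \<open>(x | z) = (S x | k)\<close> on \<open>dom S\<close>, that is, \<open>(z, - k) \<bottom> G(S)\<close>. The range condition puts \<open>k\<close> into
  \<open>dom T\<close>, and adjointness makes \<open>z - T k\<close> orthogonal to \<open>dom S\<close>. The converse is the
  Cauchy-Schwarz inequality.
\<close>

section \<open>Conjugation and real parts over both scalar fields\<close>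

lemma norm_scalar_conj [simp]: "norm (scalar_conj x) = norm (x :: 'k :: real_or_complex)"
proof -
  have "(norm (scalar_conj x))\<^sup>2 *\<^sub>R (1 :: 'k) = (norm x)\<^sup>2 *\<^sub>R 1"
    using mult_scalar_conj[of x] mult_scalar_conj[of "scalar_conj x"]
    by (simp add: scalar_conj_conj mult.commute)
  then show ?thesis
    by simp
qed

lemma scalar_conj_of_real [simp]: "scalar_conj (of_real r :: 'k :: real_or_complex) = of_real r"
  by (simp add: scalar_conj_real_iff)

lemma scalar_conj_0 [simp]: "scalar_conj (0 :: 'k :: real_or_complex) = 0"
  using scalar_conj_of_real[of 0] by simp

lemma scalar_conj_minus: "scalar_conj (- x) = - scalar_conj (x :: 'k :: real_or_complex)"
  using scalar_conj_add[of x "- x"] by (simp add: eq_neg_iff_add_eq_0 add.commute)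

text \<open>The class axioms only say that \<open>x + scalar_conj x\<close> is a real multiple of
  \<open>1\<close>. Half of that multiple is the usual real part, for either scalar field; it is
  unique because \<open>of_real\<close> is injective.\<close>

definition real_part :: "'k :: real_or_complex \<Rightarrow> real" where
  "real_part x = (THE r. x + scalar_conj x = of_real (2 * r))"

lemma real_part_eqI: "real_part x = r" if "x + scalar_conj x = of_real (2 * r)"
  unfolding real_part_def using that by (intro the_equality) auto

lemma of_real_real_part: "of_real (2 * real_part x) = x + scalar_conj (x :: 'k :: real_or_complex)"
proof -
  obtain r where "x + scalar_conj x = r *\<^sub>R 1"
    using add_scalar_conj_real by blast
  then have *: "x + scalar_conj x = of_real (2 * (r / 2))"
    by (simp add: of_real_def)
  show ?thesis
    unfolding real_part_eqI[OF *] by (rule *[symmetric])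
qed

lemma real_part_add: "real_part (x + y) = real_part x + real_part (y :: 'k :: real_or_complex)"
  by (intro real_part_eqI)
    (simp only: distrib_left of_real_add of_real_real_part scalar_conj_add add_ac)

lemma real_part_minus: "real_part (- x) = - real_part (x :: 'k :: real_or_complex)"
  by (intro real_part_eqI)
    (simp only: mult_minus_right of_real_minus of_real_real_part scalar_conj_minus minus_add_distrib)

lemma real_part_diff: "real_part (x - y) = real_part x - real_part (y :: 'k :: real_or_complex)"
  using real_part_add[of x "- y"] by (simp add: real_part_minus)

lemma real_part_of_real_mult:
  "real_part (of_real r * x) = r * real_part (x :: 'k :: real_or_complex)"
proof (intro real_part_eqI)
  have "of_real (2 * (r * real_part x)) = of_real r * (of_real (2 * real_part x) :: 'k)"
    by simp
  then show "of_real r * x + scalar_conj (of_real r * x) = of_real (2 * (r * real_part x))"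
    by (simp only: of_real_real_part scalar_conj_mult scalar_conj_of_real distrib_left)
qed

lemma real_part_of_real: "real_part (of_real r :: 'k :: real_or_complex) = r"
  by (intro real_part_eqI) simp

lemma mult_scalar_conj_of_real: "x * scalar_conj x = of_real ((norm (x :: 'k :: real_or_complex))\<^sup>2)"
  by (simp add: mult_scalar_conj of_real_def)

text \<open>The triangle inequality for \<open>x + scalar_conj x\<close>, whose two summands have
  the same norm.\<close>

lemma abs_real_part_le: "\<bar>real_part x\<bar> \<le> norm (x :: 'k :: real_or_complex)"
proof -
  have "2 * \<bar>real_part x\<bar> = norm (of_real (2 * real_part x) :: 'k)"
    by (simp only: norm_of_real abs_mult abs_numeral)
  also have "\<dots> \<le> norm x + norm (scalar_conj x)"
    unfolding of_real_real_part by (rule norm_triangle_ineq)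
  finally show ?thesis
    by simp
qed

section \<open>Sesquilinearity, polarisation and the Cauchy-Schwarz inequality\<close>

context hilbert_space
begin

lemma ip_add_right: "ip x (y + z) = ip x y + ip x z"
  by (metis ip_conj ip_add_left scalar_conj_add)

lemma ip_scale_right: "ip x (scale c y) = scalar_conj c * ip x y"
  by (metis ip_conj ip_scale_left scalar_conj_mult)

lemma ip_minus_left: "ip (- x) y = - ip x y"
  using ip_scale_left[of "- 1" x y] by simp

lemma ip_minus_right: "ip x (- y) = - ip x y"
  by (metis ip_conj ip_minus_left scalar_conj_minus)

lemma ip_diff_right: "ip x (y - z) = ip x y - ip x z"
  using ip_add_right[of x y "- z"] by (simp add: ip_minus_right)

lemma ip_eq_0_commute: "ip x y = 0 \<longleftrightarrow> ip y x = 0"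
  by (metis ip_conj scalar_conj_0)

text \<open>The two cross terms are conjugate to each other, so they add up to twice a real
  part.\<close>

lemma norm_add_sq: "(norm (x + y))\<^sup>2 = (norm x)\<^sup>2 + (norm y)\<^sup>2 + 2 * real_part (ip x y)"
proof -
  have "of_real ((norm (x + y))\<^sup>2) = ip (x + y) (x + y)"
    by (simp only: ip_self)
  also have "\<dots> = ip x x + ip y y + (ip x y + ip y x)"
    by (simp add: ip_add_left ip_add_right)
  also have "ip x y + ip y x = of_real (2 * real_part (ip x y))"
    by (simp only: of_real_real_part ip_conj[of y x])
  finally have "(of_real ((norm (x + y))\<^sup>2) :: 'k)
      = of_real ((norm x)\<^sup>2 + (norm y)\<^sup>2 + 2 * real_part (ip x y))"
    by (simp only: ip_self of_real_add)
  then show ?thesis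
    by (simp only: of_real_eq_iff)
qed

lemma norm_diff_sq: "(norm (x - y))\<^sup>2 = (norm x)\<^sup>2 + (norm y)\<^sup>2 - 2 * real_part (ip x y)"
  using norm_add_sq[of x "- y"] by (simp add: ip_minus_right real_part_minus)

lemma norm_scale_sq: "(norm (scale c x))\<^sup>2 = (norm c)\<^sup>2 * (norm x)\<^sup>2"
proof -
  have "of_real ((norm (scale c x))\<^sup>2) = (c * scalar_conj c) * ip x x"
    by (simp only: ip_self[symmetric] ip_scale_left ip_scale_right mult_ac)
  also have "\<dots> = of_real ((norm c)\<^sup>2 * (norm x)\<^sup>2)"
    by (simp only: mult_scalar_conj_of_real ip_self of_real_mult)
  finally show ?thesis
    by (simp only: of_real_eq_iff)
qed

lemma Cauchy_Schwarz: "norm (ip x y) \<le> norm x * norm y"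
proof (cases "y = 0")
  case True
  then show ?thesis
    using ip_scale_right[of x 0 y] by simp
next
  case False
  define r where "r = inverse ((norm y)\<^sup>2)"
  have r: "r * (norm y)\<^sup>2 = 1"
    using False by (simp add: r_def)
  define a where "a = ip x y"
  \<comment> \<open>With this coefficient \<open>scale c y\<close> is the orthogonal projection of
    \<open>x\<close> onto the line of \<open>y\<close>. Its squared norm and the real part of its
    product with \<open>x\<close> are both \<open>r * (norm a)\<^sup>2\<close>, so the squared
    distance to \<open>x\<close> is \<open>(norm x)\<^sup>2\<close> minus that number.\<close>
  define c where "c = of_real r * a"
  have "ip x (scale c y) = of_real r * (a * scalar_conj a)"
    by (simp add: ip_scale_right c_def a_def scalar_conj_mult)
  then have re: "real_part (ip x (scale c y)) = r * (norm a)\<^sup>2"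
    by (simp only: mult_scalar_conj_of_real real_part_of_real_mult real_part_of_real)
  have "(norm (scale c y))\<^sup>2 = r * (norm a)\<^sup>2 * (r * (norm y)\<^sup>2)"
    unfolding norm_scale_sq by (simp add: c_def norm_mult power2_eq_square mult_ac)
  then have sq: "(norm (scale c y))\<^sup>2 = r * (norm a)\<^sup>2"
    by (simp add: r)
  have "0 \<le> (norm (x - scale c y))\<^sup>2"
    by simp
  then have "r * (norm a)\<^sup>2 \<le> (norm x)\<^sup>2"
    unfolding norm_diff_sq re sq by simp
  then have "r * (norm a)\<^sup>2 * (norm y)\<^sup>2 \<le> (norm x)\<^sup>2 * (norm y)\<^sup>2"
    by (rule mult_right_mono) simp
  also have "r * (norm a)\<^sup>2 * (norm y)\<^sup>2 = (norm a)\<^sup>2"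
    using r by (metis mult.assoc mult.commute mult_1)
  finally have "(norm a)\<^sup>2 \<le> (norm x * norm y)\<^sup>2"
    by (simp only: power_mult_distrib)
  then show ?thesis
    unfolding a_def by (rule power2_le_imp_le) simp
qed

section \<open>Riesz representation on a subspace that need not be closed\<close>

text \<open>
  The representing vector is the minimiser of \<open>v \<mapsto> \<parallel>v\<parallel>\<^sup>2 - 2 Re (\<phi> v)\<close>; working with a minimising
  sequence in \<open>V\<close> itself, \<open>\<phi>\<close> need not be extended to the closure.
\<close>

lemma Riesz_representation_on_subspace:
  assumes V: "subspace V"
    and add: "\<And>u v. u \<in> V \<Longrightarrow> v \<in> V \<Longrightarrow> \<phi> (u + v) = \<phi> u + \<phi> v"
    and mult: "\<And>c v. v \<in> V \<Longrightarrow> \<phi> (scale c v) = c * \<phi> v"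
    and bound: "\<And>v. v \<in> V \<Longrightarrow> norm (\<phi> v) \<le> M * norm v"
  obtains k where "k \<in> closure V" and "\<And>v. v \<in> V \<Longrightarrow> \<phi> v = ip v k"
proof -
  define F where "F v = (norm v)\<^sup>2 - 2 * real_part (\<phi> v)" for v
  define I where "I = Inf (F ` V)"
  \<comment> \<open>Completing the square: \<open>F v\<close> is at least
    \<open>(norm v - M)\<^sup>2 - M\<^sup>2\<close>.\<close>
  have F_ge: "- M\<^sup>2 \<le> F v" if "v \<in> V" for v
  proof -
    have "real_part (\<phi> v) \<le> M * norm v"
      using abs_real_part_le[of "\<phi> v"] bound[OF that] by linarith
    moreover have "0 \<le> (norm v - M)\<^sup>2"
      by simp
    ultimately show ?thesis
      unfolding F_def by (simp add: power2_diff mult_ac)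
  qed
  have bdd: "bdd_below (F ` V)"
    using F_ge by (intro bdd_belowI[of _ "- M\<^sup>2"]) auto
  have I_le: "I \<le> F v" if "v \<in> V" for v
    unfolding I_def using bdd that by (intro cInf_lower) auto
  have "\<exists>v\<in>V. F v < I + inverse (real (Suc n))" for n
  proof -
    have "F ` V \<noteq> {}"
      using subspace_0[OF V] by auto
    moreover have "Inf (F ` V) < I + inverse (real (Suc n))"
      unfolding I_def by simp
    ultimately show ?thesis
      using cInf_lessD[of "F ` V"] by blast
  qed
  then obtain w where w: "\<And>n. w n \<in> V" and Fw: "\<And>n. F (w n) < I + inverse (real (Suc n))"
    by metis
  \<comment> \<open>The parallelogram law at the midpoint \<open>m\<close>: the linear parts of
    \<open>F\<close> cancel, and \<open>I \<le> F m\<close> does the rest. Near-minimisers are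
    therefore close to each other.\<close>
  have near: "(norm (u - v))\<^sup>2 \<le> 2 * (F u + F v - 2 * I)" if "u \<in> V" "v \<in> V" for u v
  proof -
    define m where "m = scale (of_real (1 / 2)) (u + v)"
    have uv: "u + v \<in> V"
      using V that by (rule subspace_add)
    then have m: "m \<in> V"
      unfolding m_def by (rule subspace_scale[OF V])
    have "\<phi> m = of_real (1 / 2) * (\<phi> u + \<phi> v)"
      unfolding m_def by (simp only: mult[OF uv] add[OF that])
    then have re: "real_part (\<phi> m) = 1 / 2 * (real_part (\<phi> u) + real_part (\<phi> v))"
      by (simp only: real_part_of_real_mult real_part_add)
    have "(norm m)\<^sup>2 = 1 / 4 * (norm (u + v))\<^sup>2"
      unfolding m_def scale_of_real by (simp add: power2_eq_square)
    then have "2 * (F u + F v - 2 * F m) = 2 * (norm u)\<^sup>2 + 2 * (norm v)\<^sup>2 - (norm (u + v))\<^sup>2"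
      unfolding F_def re by argo
    also have "\<dots> = (norm (u - v))\<^sup>2"
      unfolding norm_add_sq norm_diff_sq by simp
    finally show ?thesis
      using I_le[OF m] by argo
  qed
  have "Cauchy w"
  proof (rule metric_CauchyI)
    fix e :: real
    assume "0 < e"
    \<comment> \<open>Both \<open>F (w m)\<close> and \<open>F (w n)\<close> exceed \<open>I\<close>
      by less than this quarter, and \<open>near\<close> doubles the sum of the two
      excesses.\<close>
    then have "0 < e\<^sup>2 / 4"
      by simp
    then obtain N where N: "inverse (real (Suc N)) < e\<^sup>2 / 4"
      using reals_Archimedean by blast
    have "dist (w m) (w n) < e" if "m \<ge> N" "n \<ge> N" for m n
    proof -
      have "inverse (real (Suc m)) \<le> inverse (real (Suc N))"
        "inverse (real (Suc n)) \<le> inverse (real (Suc N))"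
        using that by (auto intro: le_imp_inverse_le)
      then have "(norm (w m - w n))\<^sup>2 < e\<^sup>2"
        using near[OF w w, of m n] Fw[of m] Fw[of n] N by argo
      then show ?thesis
        unfolding dist_norm using \<open>0 < e\<close> by (intro power2_less_imp_less[of _ e]) auto
    qed
    then show "\<exists>N. \<forall>m\<ge>N. \<forall>n\<ge>N. dist (w m) (w n) < e"
      by blast
  qed
  then obtain k where lim: "w \<longlonglongrightarrow> k"
    by (meson Cauchy_convergent convergentD)
  have kV: "k \<in> closure V"
    unfolding closure_sequential using w lim by blast
  \<comment> \<open>A first-variation inequality. As \<open>k\<close> may lie outside
    \<open>V\<close>, where nothing is known of \<open>\<phi>\<close>, \<open>F (v + w n)\<close> is
    compared with \<open>F (w n)\<close>. Replacing \<open>w n\<close> by \<open>k\<close> costs a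
    Cauchy-Schwarz term that vanishes in the limit.\<close>
  have variation: "2 * real_part (\<phi> v - ip v k) \<le> (norm v)\<^sup>2" if v: "v \<in> V" for v
  proof -
    have "2 * real_part (\<phi> v - ip v k)
        \<le> (norm v)\<^sup>2 + 2 * (norm v * norm (w n - k)) + inverse (real (Suc n))" for n
    proof -
      have "I \<le> F (v + w n)"
        using I_le subspace_add[OF V v w] by blast
      then have "2 * real_part (\<phi> v) \<le> (norm v)\<^sup>2 + 2 * real_part (ip v (w n)) + inverse (real (Suc n))"
        using Fw[of n] unfolding F_def by (simp only: norm_add_sq add[OF v w] real_part_add) argo
      moreover have "real_part (ip v (w n)) - real_part (ip v k) \<le> norm v * norm (w n - k)"
        using abs_real_part_le[of "ip v (w n - k)"] Cauchy_Schwarz[of v "w n - k"]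
        by (simp add: ip_diff_right real_part_diff)
      ultimately show ?thesis
        by (simp only: real_part_diff) argo
    qed
    moreover have "(\<lambda>n. (norm v)\<^sup>2 + 2 * (norm v * norm (w n - k)) + inverse (real (Suc n)))
        \<longlonglongrightarrow> (norm v)\<^sup>2 + 2 * (norm v * norm (k - k)) + 0"
      by (intro tendsto_intros lim LIMSEQ_inverse_real_of_nat)
    ultimately show ?thesis
      using LIMSEQ_le_const by fastforce
  qed
  have "\<phi> v = ip v k" if v: "v \<in> V" for v
  proof (rule ccontr)
    define d where "d = \<phi> v - ip v k"
    assume "\<phi> v \<noteq> ip v k"
    then have d: "0 < (norm d)\<^sup>2"
      by (simp add: d_def)
    \<comment> \<open>In \<open>variation\<close> at a multiple of \<open>v\<close> of size
      \<open>t\<close>, the left side is linear in \<open>t\<close> and the right side quadratic, so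
      a small \<open>t\<close> gives a contradiction. Here
      \<open>t * (norm v)\<^sup>2 \<le> 1\<close> suffices; the summand \<open>1\<close> covers
      \<open>v = 0\<close>.\<close>
    define t where "t = inverse ((norm v)\<^sup>2 + 1)"
    have pos: "0 < (norm v)\<^sup>2 + 1"
      by (simp add: add_nonneg_pos)
    then have t: "0 < t" "t * ((norm v)\<^sup>2 + 1) = 1"
      by (simp_all add: t_def)
    \<comment> \<open>The conjugate turns the defect \<open>c * d\<close> into the nonnegative real
      \<open>t * (norm d)\<^sup>2\<close>.\<close>
    define c where "c = of_real t * scalar_conj d"
    have "\<phi> (scale c v) - ip (scale c v) k = of_real t * (d * scalar_conj d)"
      by (simp add: mult[OF v] ip_scale_left c_def d_def algebra_simps)
    then have re: "real_part (\<phi> (scale c v) - ip (scale c v) k) = t * (norm d)\<^sup>2"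
      by (simp only: mult_scalar_conj_of_real real_part_of_real_mult real_part_of_real)
    have "2 * (t * (norm d)\<^sup>2) \<le> (norm c)\<^sup>2 * (norm v)\<^sup>2"
      using variation[OF subspace_scale[OF V v], of c] unfolding re norm_scale_sq .
    also have "\<dots> = t * (norm d)\<^sup>2 * (t * (norm v)\<^sup>2)"
      by (simp add: c_def norm_mult power2_eq_square mult_ac)
    also have "\<dots> \<le> t * (norm d)\<^sup>2 * 1"
      using t d by (intro mult_left_mono) (simp_all add: distrib_left)
    finally show False
      using t d by (simp add: mult_le_0_iff not_less[symmetric])
  qed
  with kV show thesis
    by (rule that)
qed

end

section \<open>Norm bounds and the sum of \<open>ran T\<close> with the orthogonal complement of
  \<open>dom S\<close>\<close>

theorem theorem5p1:
  fixes scaleH :: "'k :: real_or_complex \<Rightarrow> 'h :: banach \<Rightarrow> 'h"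
    and ipH :: "'h \<Rightarrow> 'h \<Rightarrow> 'k"
    and scaleK :: "'k \<Rightarrow> 'g :: banach \<Rightarrow> 'g"
    and ipK :: "'g \<Rightarrow> 'g \<Rightarrow> 'k"
    and S :: "'h \<rightharpoonup> 'g" and T :: "'g \<rightharpoonup> 'h" and z :: 'h
  assumes "hilbert_space scaleH ipH" and "hilbert_space scaleK ipK"
    and "linear_operator scaleH scaleK S" and "linear_operator scaleK scaleH T"
    and "adjoint_to_each_other ipH ipK S T"
    and "closure (ran S) \<inter> fst ` (flip ` orth_compl (prod_ip ipH ipK) (Map.graph S)) \<subseteq> dom T"
  shows "z \<in> ran T + orth_compl ipH (dom S) \<longleftrightarrow>
    (\<exists>M\<ge>0. \<forall>x\<in>dom S. norm (ipH x z) \<le> M * norm (the (S x)))"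
proof -
  interpret H: hilbert_space scaleH ipH by fact
  interpret K: hilbert_space scaleK ipK by fact
  define A where "A x = the (S x)" for x
  define B where "B k = the (T k)" for k
  have D: "H.subspace (dom S)"
    and A_add: "\<And>x y. x \<in> dom S \<Longrightarrow> y \<in> dom S \<Longrightarrow> A (x + y) = A x + A y"
    and A_scale: "\<And>c x. x \<in> dom S \<Longrightarrow> A (scaleH c x) = scaleK c (A x)"
    using assms(3) by (simp_all add: linear_operator_def A_def)
  have adj: "ipK (A h) k = ipH h (B k)" if "h \<in> dom S" "k \<in> dom T" for h k
    using assms(5) that by (simp add: adjoint_to_each_other_def A_def B_def)
  have ranS: "ran S = A ` dom S"
    by (force simp: ran_def A_def)
  have ranT: "ran T = B ` dom T"
    by (force simp: ran_def B_def)
  have graph: "Map.graph S = (\<lambda>x. (x, A x)) ` dom S"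
    by (force simp: Map.graph_def A_def)
  show ?thesis
    unfolding A_def[symmetric]
  proof
    assume "z \<in> ran T + orth_compl ipH (dom S)"
    then obtain k u where k: "k \<in> dom T" and u: "u \<in> orth_compl ipH (dom S)" and z: "z = B k + u"
      unfolding ranT by (auto elim!: set_plus_elim)
    \<comment> \<open>The component \<open>u\<close> is invisible on \<open>dom S\<close>, so only
      \<open>B k\<close> counts, and adjointness moves it to \<open>k\<close>; hence the constant
      \<open>norm k\<close>.\<close>
    have "norm (ipH x z) \<le> norm k * norm (A x)" if x: "x \<in> dom S" for x
    proof -
      have "ipH x u = 0"
        using u x by (simp add: orth_compl_def H.ip_eq_0_commute)
      then have "ipH x z = ipK (A x) k"
        by (simp add: z H.ip_add_right adj[OF x k])
      then show ?thesis
        using K.Cauchy_Schwarz[of "A x" k] by (simp add: mult.commute)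
    qed
    then show "\<exists>M\<ge>0. \<forall>x\<in>dom S. norm (ipH x z) \<le> M * norm (A x)"
      by (intro exI[of _ "norm k"]) simp
  next
    assume "\<exists>M\<ge>0. \<forall>x\<in>dom S. norm (ipH x z) \<le> M * norm (A x)"
    then obtain M where M: "\<And>x. x \<in> dom S \<Longrightarrow> norm (ipH x z) \<le> M * norm (A x)"
      by blast
    \<comment> \<open>The bound is applied to the difference of \<open>x\<close> and
      \<open>y\<close>, which \<open>A\<close> sends to \<open>0\<close>. The difference is written
      with \<open>scaleH (- 1)\<close> to fit the linearity rules for \<open>A\<close>.\<close>
    have well_defined: "ipH x z = ipH y z" if "x \<in> dom S" "y \<in> dom S" "A x = A y" for x y
    proof -
      have neg: "scaleH (- 1) y \<in> dom S"
        by (rule H.subspace_scale[OF D that(2)])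
      have "A (x + scaleH (- 1) y) = 0"
        using that by (simp only: A_add[OF that(1) neg] A_scale[OF that(2)]) simp
      then have "ipH (x + scaleH (- 1) y) z = 0"
        using M[OF H.subspace_add[OF D that(1) neg]] by simp
      then show ?thesis
        by (simp only: H.ip_add_left H.ip_scale_left) simp
    qed
    \<comment> \<open>Any preimage under \<open>A\<close> would do, by \<open>well_defined\<close>.
      Off \<open>ran S\<close> the value is arbitrary, and only values on \<open>ran S\<close> are
      used.\<close>
    define \<phi> where "\<phi> y = ipH (SOME x. x \<in> dom S \<and> A x = y) z" for y
    have \<phi>: "\<phi> (A x) = ipH x z" if x: "x \<in> dom S" for x
    proof -
      have "(SOME y. y \<in> dom S \<and> A y = A x) \<in> dom S \<and> A (SOME y. y \<in> dom S \<and> A y = A x) = A x"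
        by (rule someI[of _ x]) (simp add: x)
      then show ?thesis
        unfolding \<phi>_def using well_defined x by blast
    qed
    have A0: "A 0 = 0"
      using A_scale[OF H.subspace_0[OF D], of 0] by simp
    obtain k where k: "k \<in> closure (ran S)" and rep: "\<And>y. y \<in> ran S \<Longrightarrow> \<phi> y = ipK y k"
    proof (rule K.Riesz_representation_on_subspace[of "ran S" \<phi> M])
      show "K.subspace (ran S)"
      proof (rule K.subspaceI)
        show "0 \<in> ran S"
          unfolding ranS using A0 H.subspace_0[OF D] by force
        show "x + y \<in> ran S" if xy: "x \<in> ran S" "y \<in> ran S" for x y
        proof -
          obtain a b where "a \<in> dom S" "b \<in> dom S" "x = A a" "y = A b"
            using xy unfolding ranS by blast
          then show ?thesis
            unfolding ranS using H.subspace_add[OF D] by (intro image_eqI[of _ _ "a + b"]) (simp_all only: A_add)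
        qed
        show "scaleK c x \<in> ran S" if x: "x \<in> ran S" for c x
        proof -
          obtain a where "a \<in> dom S" "x = A a"
            using x unfolding ranS by blast
          then show ?thesis
            unfolding ranS using H.subspace_scale[OF D] by (intro image_eqI[of _ _ "scaleH c a"]) (simp_all only: A_scale)
        qed
      qed
      show "\<phi> (u + v) = \<phi> u + \<phi> v" if uv: "u \<in> ran S" "v \<in> ran S" for u v
      proof -
        obtain x y where xy: "x \<in> dom S" "y \<in> dom S" "u = A x" "v = A y"
          using uv unfolding ranS by blast
        then show ?thesis
          using \<phi>[OF H.subspace_add[OF D xy(1,2)]]
          by (simp only: A_add \<phi> H.ip_add_left)
      qed
      show "\<phi> (scaleK c v) = c * \<phi> v" if v: "v \<in> ran S" for c v
      proof -
        obtain x where x: "x \<in> dom S" "v = A x"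
          using v unfolding ranS by blast
        then show ?thesis
          using \<phi>[OF H.subspace_scale[OF D x(1)], of c]
          by (simp only: A_scale \<phi> H.ip_scale_left)
      qed
      show "norm (\<phi> v) \<le> M * norm v" if v: "v \<in> ran S" for v
        using v M \<phi> unfolding ranS by fastforce
    qed (rule that)
    have eq: "ipH x z = ipK (A x) k" if "x \<in> dom S" for x
      using rep \<phi> that unfolding ranS by fastforce
    \<comment> \<open>\<open>orth_compl\<close> has the graph element as second argument, so the
      identity is conjugated first.\<close>
    then have "ipH z x = ipK k (A x)" if "x \<in> dom S" for x
      using that by (metis H.ip_conj K.ip_conj)
    then have "(z, - k) \<in> orth_compl (prod_ip ipH ipK) (Map.graph S)"
      by (simp add: orth_compl_def prod_ip_def graph K.ip_minus_left del: domIff)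
    \<comment> \<open>The sign in \<open>(z, - k)\<close> is undone by \<open>flip\<close>, which
      maps this pair to \<open>(k, z)\<close>.\<close>
    then have "k \<in> fst ` (flip ` orth_compl (prod_ip ipH ipK) (Map.graph S))"
      by (force simp: flip_def image_iff)
    then have kT: "k \<in> dom T"
      using k assms(6) by blast
    have "ipH (z - B k) x = 0" if x: "x \<in> dom S" for x
      using eq[OF x] adj[OF x kT] H.ip_diff_right[of x z "B k"] by (simp add: H.ip_eq_0_commute[of _ x])
    then have "z - B k \<in> orth_compl ipH (dom S)"
      by (simp add: orth_compl_def del: domIff)
    moreover have "B k \<in> ran T"
      unfolding ranT using kT by blast
    ultimately have "B k + (z - B k) \<in> ran T + orth_compl ipH (dom S)"
      by (rule set_plus_intro[rotated])
    then show "z \<in> ran T + orth_compl ipH (dom S)"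
      by simp
  qed
qed

end
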